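(* Let $u$ be a sufficiently regular exact solution (in the sense specified in the context) of $$u_t+\mathcal L^su=r(t)f(t,x)\ \text{ in }(0,T]\times(0,l),\qquad u(0,\cdot)=\varphi,\qquad u(t,0)=u(t,l)=0 .$$ Assume that there is a constant $C_t$ such that, uniformly with respect to $h$, $$\sup_{0\le t\le T}\left(\|(u_{ttt}(t))_h\|_h+\|((rf)_{tt}(t))_h\|_h\right)\le C_t .$$ Assume further that the spatial consistency estimate $$\|A_hv_h-(\mathcal L^sv)_h\|_h\le C_vh^2$$ holds uniformly for $v=u(t,\cdot)$, $0\le t\le T$, with a constant $C_v$ independent of $h$ (and of $t$). Let $U^n$, $0\le n\le M$, be the solution of the Crank--Nicolson scheme $$\frac{U^{n+1}-U^n}{\tau}+A_h\frac{U^{n+1}+U^n}{2}=r^{n+\frac12}F^{n+\frac12},\qquad n=0,\dots,M-1,$$ with exact initial data $U^0=u_h^0$. Then there exists a constant $C>0$, independent of $h$ and $\tau$, such that $$\max_{0\le n\le M}\|u_h^n-U^n\|_h\le C(\tau^2+h^2)$$ and $$\max_{0\le n\le M}\|u_h^n-U^n\|_{A_h,h}\le C(\tau^2+h^2).$$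
   Context: Let $l,T>0$, $0<s<1$. $\mathcal L=-d^2/dx^2$ with domain $H^2(0,l)\cap H^1_0(0,l)$ is the Dirichlet Laplacian on $L^2(0,l)$, with eigenpairs $\phi_k(x)=\sqrt{2/l}\,\sin(k\pi x/l)$, $\lambda_k=(k\pi/l)^2$, $k\ge1$. The spectral fractional Laplacian is $\mathcal L^sv=\sum_{k\ge1}\lambda_k^s(v,\phi_k)_{L^2}\phi_k$ with domain $D(\mathcal L^s)=\{v\in L^2(0,l):\sum_k\lambda_k^{2s}|(v,\phi_k)_{L^2}|^2<\infty\}$. Discretisation: for integers $N\ge2$, $M\ge1$ put $h=l/N$, $x_i=ih$, $\tau=T/M$, $t_n=n\tau$, $t_{n+\frac12}=(t_n+t_{n+1})/2$. For a continuous function $v$, $v_h=(v(x_1),\dots,v(x_{N-1}))^T\in\mathbb R^{N-1}$; $u_h^n=(u(t_n,\cdot))_h$; $r^{n+\frac12}=r(t_{n+\frac12})$; $F^{n+\frac12}=(f(t_{n+\frac12},x_i))_{i=1}^{N-1}$. On $\mathbb R^{N-1}$: $\langle v,z\rangle_h=h\sum_{i=1}^{N-1}v_iz_i$, $\|v\|_h^2=\langle v,v\rangle_h$, $\|v\|_{A_h,h}^2=\langle A_hv,v\rangle_h$. $L_h=\frac1{h^2}\,\mathrm{tridiag}(-1,2,-1)\in\mathbb R^{(N-1)\times(N-1)}$ has the spectral decomposition $L_h=Q\Lambda_hQ^T$ with $Q_{ik}=\sqrt{2/N}\,\sin(ik\pi/N)$, $\Lambda_h=\mathrm{diag}(\lambda_{k,h})$,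 $\lambda_{k,h}=\frac4{h^2}\sin^2\left(\frac{k\pi}{2N}\right)$, and $A_h:=L_h^s=Q\Lambda_h^sQ^T$. "Sufficiently regular" means: for every $t\in[0,T]$, $u(t,\cdot)\in D(\mathcal L^s)$, and $u(t,\cdot)$, $u_t(t,\cdot)$, $r(t)f(t,\cdot)$ and $\mathcal L^su(t,\cdot)$ are represented by continuous functions; the equation $u_t+\mathcal L^su=rf$ holds pointwise at every $t\in[0,T]$ and $x\in(0,l)$; and for each $x$, $t\mapsto u(t,x)$ is three times and $t\mapsto r(t)f(t,x)$ twice continuously differentiable on $[0,T]$. The constant $C$ is to hold for all $N\ge2$ and $M\ge1$. *)

theory Defs
  imports "HOL-Analysis.Analysis" "Jordan_Normal_Form.Matrix"
begin

unbundle no vec_syntax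
unbundle no inner_syntax

definition L2_fun :: "real \<Rightarrow> (real \<Rightarrow> real) \<Rightarrow> bool" where
  "L2_fun l v \<longleftrightarrow> v \<in> borel_measurable (lebesgue_on {0<..<l}) \<and>
     integrable (lebesgue_on {0<..<l}) (\<lambda>x. (v x)\<^sup>2)"

definition L2_inner :: "real \<Rightarrow> (real \<Rightarrow> real) \<Rightarrow> (real \<Rightarrow> real) \<Rightarrow> real" where
  "L2_inner l v w = integral\<^sup>L (lebesgue_on {0<..<l}) (\<lambda>x. v x * w x)"

definition L2_norm :: "real \<Rightarrow> (real \<Rightarrow> real) \<Rightarrow> real" where
  "L2_norm l v = sqrt (L2_inner l v v)"

definition eigfun :: "real \<Rightarrow> nat \<Rightarrow> real \<Rightarrow> real" where
  "eigfun l k x = sqrt (2 / l) * sin (real k * pi * x / l)"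

definition eigval :: "real \<Rightarrow> nat \<Rightarrow> real" where
  "eigval l k = (real k * pi / l)\<^sup>2"

text \<open>Eigenpairs are numbered from 1, hence the shift by \<open>Suc\<close>.\<close>

definition frac_lap_dom :: "real \<Rightarrow> real \<Rightarrow> (real \<Rightarrow> real) set" where
  "frac_lap_dom l s = {v. L2_fun l v \<and>
     summable (\<lambda>k. eigval l (Suc k) powr (2 * s) * \<bar>L2_inner l v (eigfun l (Suc k))\<bar>\<^sup>2)}"

text \<open>
  Elements of \<open>L\<^sup>2(0,l)\<close> are given by representing functions. \<open>frac_lap l s v w\<close> says that
  \<open>v\<close> lies in the domain of the fractional Laplacian and that \<open>w\<close> represents its image, the series
  being convergent in \<open>L\<^sup>2(0,l)\<close>. This determines \<open>w\<close> up to a null set of \<open>(0,l)\<close>, and thus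
  everywhere on \<open>(0,l)\<close> if \<open>w\<close> is continuous there.
\<close>

definition frac_lap :: "real \<Rightarrow> real \<Rightarrow> (real \<Rightarrow> real) \<Rightarrow> (real \<Rightarrow> real) \<Rightarrow> bool" where
  "frac_lap l s v w \<longleftrightarrow> v \<in> frac_lap_dom l s \<and> L2_fun l w \<and>
     (\<lambda>n. L2_norm l (\<lambda>x. w x -
        (\<Sum>k=1..n. eigval l k powr s * L2_inner l v (eigfun l k) * eigfun l k x)))
     \<longlonglongrightarrow> 0"

text \<open>Derivatives are taken within \<open>S\<close>, so they are one-sided at the end points of an interval.\<close>

definition deriv_on :: "real set \<Rightarrow> (real \<Rightarrow> real) \<Rightarrow> real \<Rightarrow> real" where
  "deriv_on S g = (\<lambda>t. vector_derivative g (at t within S))"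

definition Ck_on :: "nat \<Rightarrow> real set \<Rightarrow> (real \<Rightarrow> real) \<Rightarrow> bool" where
  "Ck_on k S g \<longleftrightarrow> (\<forall>j<k. ((deriv_on S ^^ j) g) differentiable_on S) \<and>
     continuous_on S ((deriv_on S ^^ k) g)"

definition dt :: "real \<Rightarrow> nat \<Rightarrow> (real \<Rightarrow> real \<Rightarrow> real) \<Rightarrow> real \<Rightarrow> real \<Rightarrow> real" where
  "dt T k g t x = (deriv_on {0..T} ^^ k) (\<lambda>t'. g t' x) t"

text \<open>Vectors in \<open>\<real>\<^sup>N\<^sup>-\<^sup>1\<close> and matrices are 0-based: index \<open>i\<close> here is the grid index \<open>Suc i\<close>.\<close>

definition mesh :: "real \<Rightarrow> nat \<Rightarrow> real" where
  "mesh l N = l / real N"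

definition grid :: "real \<Rightarrow> nat \<Rightarrow> (real \<Rightarrow> real) \<Rightarrow> real vec" where
  "grid l N v = Matrix.vec (N - 1) (\<lambda>i. v (real (Suc i) * mesh l N))"

definition inner_h :: "real \<Rightarrow> nat \<Rightarrow> real vec \<Rightarrow> real vec \<Rightarrow> real" where
  "inner_h l N v z = mesh l N * (v \<bullet> z)"

definition norm_h :: "real \<Rightarrow> nat \<Rightarrow> real vec \<Rightarrow> real" where
  "norm_h l N v = sqrt (inner_h l N v v)"

definition L_h :: "real \<Rightarrow> nat \<Rightarrow> real mat" where
  "L_h l N = (1 / (mesh l N)\<^sup>2) \<cdot>\<^sub>m Matrix.mat (N - 1) (N - 1)
     (\<lambda>(i, j). if i = j then 2 else if i = Suc j \<or> j = Suc i then - 1 else 0)"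

definition Q_h :: "nat \<Rightarrow> real mat" where
  "Q_h N = Matrix.mat (N - 1) (N - 1)
     (\<lambda>(i, k). sqrt (2 / real N) * sin (real (Suc i) * real (Suc k) * pi / real N))"

definition eigval_h :: "real \<Rightarrow> nat \<Rightarrow> nat \<Rightarrow> real" where
  "eigval_h l N k = 4 / (mesh l N)\<^sup>2 * (sin (real k * pi / (2 * real N)))\<^sup>2"

definition A_h :: "real \<Rightarrow> nat \<Rightarrow> real \<Rightarrow> real mat" where
  "A_h l N s = Q_h N * mat_diag (N - 1) (\<lambda>k. eigval_h l N (Suc k) powr s) * (Q_h N)\<^sup>T"

definition norm_A :: "real \<Rightarrow> nat \<Rightarrow> real \<Rightarrow> real vec \<Rightarrow> real" where
  "norm_A l N s v = sqrt (inner_h l N (A_h l N s *\<^sub>v v) v)"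

text \<open>
  \<open>A_h\<close> is the \<open>s\<close>-th power of \<open>L_h\<close>: \<open>Q_h\<close> is orthogonal and diagonalises \<open>L_h\<close>, see
  \<open>Q_h_orthogonal\<close> and \<open>L_h_spectral\<close>.
\<close>

lemma sum_cos_aux:
  fixes x :: real
  shows "2 * sin (x / 2) * (\<Sum>i<n. cos (real (Suc i) * x)) = sin ((real n + 1/2) * x) - sin (x / 2)"
proof (induction n)
  case (Suc n)
  have "2 * sin (x / 2) * cos (real (Suc n) * x)
      = sin (x / 2 + real (Suc n) * x) + sin (x / 2 - real (Suc n) * x)"
    by (simp add: sin_add sin_diff)
  moreover have "sin (x / 2 - real (Suc n) * x) = - sin ((real n + 1/2) * x)"
    by (subst sin_minus [symmetric]) (simp add: algebra_simps)
  moreover have "x / 2 + real (Suc n) * x = (real (Suc n) + 1/2) * x"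
    by (simp add: algebra_simps)
  ultimately show ?case
    using Suc by (simp add: distrib_left)
qed simp

lemma sum_cos_grid:
  assumes "0 < m" "m < 2 * N"
  shows "(\<Sum>i<N - 1. cos (real (Suc i) * (real m * pi / real N))) = (- ((- 1) ^ m) - 1) / 2"
proof -
  define x where "x = real m * pi / real N"
  have N: "N > 0" using assms by simp
  have "x / 2 > 0" using assms N by (simp add: x_def)
  moreover have "x / 2 < pi"
    using assms N by (simp add: x_def field_simps flip: of_nat_mult)
  ultimately have s0: "sin (x / 2) \<noteq> 0"
    using sin_gt_zero by fastforce
  have "(real (N - 1) + 1/2) * x = real m * pi - x / 2"
    using N by (simp add: x_def field_simps of_nat_diff)
  then have "sin ((real (N - 1) + 1/2) * x) = - ((- 1) ^ m) * sin (x / 2)"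
    by (simp add: sin_diff)
  with sum_cos_aux [of x "N - 1"]
  have "2 * sin (x / 2) * (\<Sum>i<N - 1. cos (real (Suc i) * x))
      = sin (x / 2) * (- ((- 1) ^ m) - 1)"
    by (simp add: algebra_simps)
  then have "(2 * (\<Sum>i<N - 1. cos (real (Suc i) * x)) - (- ((- 1) ^ m) - 1)) * sin (x / 2) = 0"
    by (simp only: left_diff_distrib right_diff_distrib mult_ac)
  then have "2 * (\<Sum>i<N - 1. cos (real (Suc i) * x)) = - ((- 1) ^ m) - 1"
    using s0 by (simp only: mult_eq_0_iff) simp
  then show ?thesis
    unfolding x_def by (metis nonzero_mult_div_cancel_left zero_neq_numeral)
qed

lemma sum_sin_sin:
  assumes "0 < j" "j < N" "0 < k" "k < N"
  shows "(\<Sum>i<N - 1. sin (real (Suc i) * (real j * pi / real N)) * sin (real (Suc i) * (real k * pi / real N)))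
    = (if j = k then real N / 2 else 0)"
proof -
  define c where "c m = (\<Sum>i<N - 1. cos (real (Suc i) * (real m * pi / real N)))" for m
  have *: "(\<Sum>i<N - 1. sin (real (Suc i) * (real j * pi / real N)) * sin (real (Suc i) * (real k * pi / real N)))
    = (c (j - k) - c (j + k)) / 2"
    if "k \<le> j" for j k
  proof -
    have "sin (real (Suc i) * (real j * pi / real N)) * sin (real (Suc i) * (real k * pi / real N))
      = (cos (real (Suc i) * (real (j - k) * pi / real N))
         - cos (real (Suc i) * (real (j + k) * pi / real N))) / 2" for i
      using that
      by (subst sin_times_sin) (simp add: of_nat_diff algebra_simps add_divide_distrib diff_divide_distrib)
    then show ?thesis
      unfolding c_def by (simp only: sum_subtractf [symmetric] sum_divide_distrib)
  qed
  show ?thesis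
  proof (cases "j = k")
    case True
    have "c (j + j) = - 1"
      unfolding c_def using assms by (subst sum_cos_grid) (auto simp: power_add simp flip: power_mult_distrib)
    moreover have "c 0 = real N - 1"
      using assms by (simp add: c_def of_nat_diff)
    ultimately show ?thesis
      using *[of k k] True by simp
  next
    case False
    have par: "c (a - b) = c (a + b)" if "b < a" "a < N" for a b
    proof -
      have "(- 1 :: real) ^ (a - b) = (- 1) ^ (a + b)"
        using that by (simp add: minus_one_power_iff)
      then show ?thesis
        unfolding c_def using that by (subst (1 2) sum_cos_grid) auto
    qed
    consider "k < j" | "j < k" using False by linarith
    then show ?thesis
    proof cases
      case 1
      then show ?thesis using *[of k j] par[of k j] assms by simp
    next
      case 2
      then show ?thesis using *[of j k] par[of j k] assms by (simp add: mult.commute)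
    qed
  qed
qed

lemma Q_h_orthogonal: "Q_h N * (Q_h N)\<^sup>T = 1\<^sub>m (N - 1)"
proof (rule eq_matI)
  fix i j assume "i < dim_row (1\<^sub>m (N - 1) :: real mat)" "j < dim_col (1\<^sub>m (N - 1) :: real mat)"
  then have ij: "i < N - 1" "j < N - 1" by simp_all
  have q: "sqrt (2 / real N) * a * (sqrt (2 / real N) * b) = 2 / real N * (a * b)" for a b
    using real_sqrt_mult_self [of "2 / real N"] by (simp add: mult_ac flip: mult.assoc)
  have "(Q_h N * (Q_h N)\<^sup>T) $$ (i, j) = (\<Sum>m<N - 1.
      sqrt (2 / real N) * sin (real (Suc m) * (real (Suc i) * pi / real N)) *
      (sqrt (2 / real N) * sin (real (Suc m) * (real (Suc j) * pi / real N))))"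
    using ij by (auto simp: Q_h_def scalar_prod_def lessThan_atLeast0 mult_ac intro!: sum.cong)
  also have "\<dots> = (\<Sum>m<N - 1. (2 / real N) *
      (sin (real (Suc m) * (real (Suc i) * pi / real N)) * sin (real (Suc m) * (real (Suc j) * pi / real N))))"
    by (simp only: q)
  also have "\<dots> = (if i = j then 1 else 0)"
    using ij by (subst sum_distrib_left [symmetric], subst sum_sin_sin) auto
  finally show "(Q_h N * (Q_h N)\<^sup>T) $$ (i, j) = 1\<^sub>m (N - 1) $$ (i, j)"
    using ij by simp
qed (auto simp: Q_h_def)

lemma L_h_spectral:
  "L_h l N = Q_h N * mat_diag (N - 1) (\<lambda>k. eigval_h l N (Suc k)) * (Q_h N)\<^sup>T"
proof -
  have Q: "Q_h N \<in> carrier_mat (N - 1) (N - 1)" by (simp add: Q_h_def)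
  have L: "L_h l N \<in> carrier_mat (N - 1) (N - 1)" by (simp add: L_h_def)
  have "L_h l N * Q_h N = Q_h N * mat_diag (N - 1) (\<lambda>k. eigval_h l N (Suc k))"
  proof (subst mat_diag_mult_right [OF Q], rule eq_matI, goal_cases)
    case (1 i k)
    then have ik: "i < N - 1" "k < N - 1" by simp_all
    define x where "x = real (Suc k) * pi / real N"
    define g where "g m = sqrt (2 / real N) * sin (real m * x)" for m
    have gN: "g N = 0"
    proof -
      have "real N * x = real (Suc k) * pi" using ik by (simp add: x_def)
      then show ?thesis unfolding g_def by (simp only: sin_npi mult_zero_right)
    qed
    have g0: "g 0 = 0" by (simp add: g_def)
    have "(L_h l N * Q_h N) $$ (i, k) = (\<Sum>m<N - 1. (1 / (mesh l N)\<^sup>2) *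
       ((if m = i then 2 * g (Suc m) else 0) - (if m = Suc i then g (Suc m) else 0)
         - (if Suc m = i then g (Suc m) else 0)))"
      using ik by (auto simp: L_h_def Q_h_def scalar_prod_def lessThan_atLeast0 g_def x_def mult_ac
            intro!: sum.cong)
    also have "\<dots> = (1 / (mesh l N)\<^sup>2) * ((\<Sum>m<N - 1. if m = i then 2 * g (Suc m) else 0)
         - (\<Sum>m<N - 1. if m = Suc i then g (Suc m) else 0)
         - (\<Sum>m<N - 1. if Suc m = i then g (Suc m) else 0))"
      by (simp only: sum_distrib_left [symmetric] sum_subtractf)
    also have "(\<Sum>m<N - 1. if m = i then 2 * g (Suc m) else 0) = 2 * g (Suc i)"
      using ik by simp
    also have "(\<Sum>m<N - 1. if m = Suc i then g (Suc m) else 0) = g (Suc (Suc i))"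
    proof (cases "Suc i < N - 1")
      case False
      then have "Suc (Suc i) = N" using ik by simp
      with False show ?thesis using gN by simp
    qed simp
    also have "(\<Sum>m<N - 1. if Suc m = i then g (Suc m) else 0) = g i"
    proof (cases i)
      case 0
      then show ?thesis using g0 by simp
    next
      case (Suc i')
      then show ?thesis using ik by simp
    qed
    also have "2 * g (Suc i) - g (Suc (Suc i)) - g i = 4 * (sin (x / 2))\<^sup>2 * g (Suc i)"
    proof -
      define y where "y = real (Suc i) * x"
      have "g (Suc (Suc i)) = sqrt (2 / real N) * sin (y + x)"
        "g i = sqrt (2 / real N) * sin (y - x)"
        "g (Suc i) = sqrt (2 / real N) * sin y"
        by (simp_all add: g_def y_def algebra_simps)
      moreover have "cos x = 1 - 2 * (sin (x / 2))\<^sup>2"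
        using cos_double_sin [of "x / 2"] by simp
      ultimately show ?thesis
        by (simp add: sin_add sin_diff algebra_simps)
    qed
    finally show ?case
      using ik by (simp add: eigval_h_def Q_h_def g_def x_def mult_ac)
  qed (auto simp: L_h_def Q_h_def)
  then have "Q_h N * mat_diag (N - 1) (\<lambda>k. eigval_h l N (Suc k)) * (Q_h N)\<^sup>T
      = L_h l N * (Q_h N * (Q_h N)\<^sup>T)"
    using L Q by (metis assoc_mult_mat transpose_carrier_mat)
  then show ?thesis
    using L by (simp add: Q_h_orthogonal)
qed

definition time_step :: "real \<Rightarrow> nat \<Rightarrow> real" where
  "time_step T M = T / real M"

definition time_pt :: "real \<Rightarrow> nat \<Rightarrow> nat \<Rightarrow> real" where
  "time_pt T M n = real n * time_step T M"

definition time_mid :: "real \<Rightarrow> nat \<Rightarrow> nat \<Rightarrow> real" where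
  "time_mid T M n = (time_pt T M n + time_pt T M (Suc n)) / 2"

definition crank_nicolson ::
  "real \<Rightarrow> real \<Rightarrow> real \<Rightarrow> (real \<Rightarrow> real) \<Rightarrow> (real \<Rightarrow> real \<Rightarrow> real) \<Rightarrow> nat \<Rightarrow> nat \<Rightarrow> (nat \<Rightarrow> real vec) \<Rightarrow> bool"
  where
  "crank_nicolson l T s r f N M U \<longleftrightarrow>
     (\<forall>n\<le>M. U n \<in> carrier_vec (N - 1)) \<and>
     (\<forall>n<M. (1 / time_step T M) \<cdot>\<^sub>v (U (Suc n) - U n)
            + A_h l N s *\<^sub>v ((1 / 2) \<cdot>\<^sub>v (U (Suc n) + U n))
          = r (time_mid T M n) \<cdot>\<^sub>v grid l N (f (time_mid T M n)))"

end

theory Submission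
  imports Defs
begin

text \<open>
  The truncation error of the scheme is estimated by duality: paired with a fixed grid vector \<open>z\<close>,
  the semidiscrete functions become scalar functions of \<open>t\<close>, so scalar Taylor expansion about the
  midpoint applies, and \<open>z\<close> is finally chosen as the truncation error itself. The term
  \<open>\<L>\<^sup>s u = r f - u\<^sub>t\<close> is twice differentiable in time because the right-hand side is.
  Stability comes from testing the error equation with the sum of two successive errors for
  the \<open>h\<close>-norm and with their difference for the energy norm.
\<close>

text \<open>The dimension \<open>N - 1\<close> and orders such as \<open>g 1\<close> keep the
  numeral \<open>1\<close> under simplification, so that they match the facts stated with
  it.\<close>

declare One_nat_def [simp del]

section \<open>Discrete inner product and norm\<close>

lemma inner_h_sum:
  "z \<in> carrier_vec n \<Longrightarrow> inner_h l N v z = mesh l N * (\<Sum>i<n. v $ i * z $ i)"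
  by (auto simp: inner_h_def scalar_prod_def lessThan_atLeast0)

lemma inner_h_commute:
  assumes "v \<in> carrier_vec n" "z \<in> carrier_vec n"
  shows "inner_h l N v z = inner_h l N z v"
  using assms by (simp add: inner_h_sum mult.commute)

lemma inner_h_add_right:
  assumes "v \<in> carrier_vec n" "w \<in> carrier_vec n" "z \<in> carrier_vec n"
  shows "inner_h l N z (v + w) = inner_h l N z v + inner_h l N z w"
  using assms by (simp add: inner_h_def scalar_prod_add_distrib distrib_left)

lemma inner_h_diff_right:
  assumes "v \<in> carrier_vec n" "w \<in> carrier_vec n" "z \<in> carrier_vec n"
  shows "inner_h l N z (v - w) = inner_h l N z v - inner_h l N z w"
  using assms by (simp add: inner_h_def scalar_prod_minus_distrib right_diff_distrib)

lemma inner_h_smult_right: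
  assumes "v \<in> carrier_vec n" "z \<in> carrier_vec n"
  shows "inner_h l N z (c \<cdot>\<^sub>v v) = c * inner_h l N z v"
  using assms by (simp add: inner_h_def)

lemma inner_h_add_left:
  assumes "v \<in> carrier_vec n" "w \<in> carrier_vec n" "z \<in> carrier_vec n"
  shows "inner_h l N (v + w) z = inner_h l N v z + inner_h l N w z"
  using assms by (simp add: inner_h_def add_scalar_prod_distrib distrib_left)

lemma inner_h_diff_left:
  assumes "v \<in> carrier_vec n" "w \<in> carrier_vec n" "z \<in> carrier_vec n"
  shows "inner_h l N (v - w) z = inner_h l N v z - inner_h l N w z"
  using assms by (simp add: inner_h_def minus_scalar_prod_distrib right_diff_distrib)

lemmas inner_h_linear =
  inner_h_add_right inner_h_diff_right inner_h_smult_right inner_h_add_left inner_h_diff_left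

lemma inner_h_nonneg: "l \<ge> 0 \<Longrightarrow> inner_h l N v v \<ge> 0"
  unfolding inner_h_sum[OF carrier_vec_dim_vec] mesh_def
  by (intro mult_nonneg_nonneg[of "l / real N"] sum_nonneg) simp_all

lemma norm_h_nonneg: "l \<ge> 0 \<Longrightarrow> norm_h l N v \<ge> 0"
  by (simp add: norm_h_def inner_h_nonneg)

lemma norm_h_power2: "l \<ge> 0 \<Longrightarrow> (norm_h l N v)\<^sup>2 = inner_h l N v v"
  by (simp add: norm_h_def inner_h_nonneg)

text \<open>Squares are compared: the inequality for finite sums applies, and of the two factors
  \<open>mesh l N\<close> one goes into each squared norm.\<close>

lemma inner_h_Cauchy_Schwarz:
  assumes "l \<ge> 0" "v \<in> carrier_vec n" "z \<in> carrier_vec n"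
  shows "\<bar>inner_h l N v z\<bar> \<le> norm_h l N v * norm_h l N z"
proof -
  have m: "mesh l N \<ge> 0" using assms by (simp add: mesh_def)
  have "(inner_h l N v z)\<^sup>2 = (mesh l N)\<^sup>2 * (\<Sum>i<n. v $ i * z $ i)\<^sup>2"
    using assms by (simp add: inner_h_sum power_mult_distrib)
  also have "\<dots> \<le> (mesh l N)\<^sup>2 * ((\<Sum>i<n. (v $ i)\<^sup>2) * (\<Sum>i<n. (z $ i)\<^sup>2))"
    by (intro mult_left_mono Cauchy_Schwarz_ineq_sum) simp
  also have "\<dots> = inner_h l N v v * inner_h l N z z"
    using assms by (simp add: inner_h_sum power2_eq_square)
  also have "\<dots> = (norm_h l N v * norm_h l N z)\<^sup>2"
    using assms by (simp add: power_mult_distrib norm_h_power2)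
  finally show ?thesis
    using norm_h_nonneg[OF assms(1)] by (simp add: abs_mult flip: abs_le_square_iff)
qed

section \<open>Quadratic form of the discrete fractional Laplacian\<close>

lemma grid_carrier [simp]: "grid l N v \<in> carrier_vec (N - 1)"
  by (simp add: grid_def)

lemma A_h_carrier [simp]: "A_h l N s \<in> carrier_mat (N - 1) (N - 1)"
proof -
  have "Q_h N \<in> carrier_mat (N - 1) (N - 1)" by (simp add: Q_h_def)
  then show ?thesis
    unfolding A_h_def by (intro mult_carrier_mat[where n = "N - 1"]) simp_all
qed

text \<open>Moving \<open>Q_h N\<close> to the other factor as its transpose makes the form diagonal
  in sine coefficients, with weights that are nonnegative. Symmetry and positivity of
  \<open>A_h\<close> are both read off from this.\<close>

lemma inner_h_A_h:
  assumes v: "v \<in> carrier_vec (N - 1)" and z: "z \<in> carrier_vec (N - 1)"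
  shows "inner_h l N (A_h l N s *\<^sub>v v) z =
    mesh l N * (\<Sum>k<N - 1. eigval_h l N (Suc k) powr s * (((Q_h N)\<^sup>T *\<^sub>v v) $ k * ((Q_h N)\<^sup>T *\<^sub>v z) $ k))"
proof -
  define n where "n = N - 1"
  define d where "d k = eigval_h l N (Suc k) powr s" for k
  let ?Q = "Q_h N" and ?D = "mat_diag n d"
  have Q: "?Q \<in> carrier_mat n n" "?Q\<^sup>T \<in> carrier_mat n n" by (simp_all add: Q_h_def n_def)
  have D: "?D \<in> carrier_mat n n" by simp
  define a where "a = ?Q\<^sup>T *\<^sub>v v"
  define b where "b = ?Q\<^sup>T *\<^sub>v z"
  have vz: "v \<in> carrier_vec n" "z \<in> carrier_vec n" using v z by (simp_all add: n_def)
  have ab: "a \<in> carrier_vec n" "b \<in> carrier_vec n"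
    unfolding a_def b_def using Q vz by (auto intro: mult_mat_vec_carrier)
  have Da: "?D *\<^sub>v a \<in> carrier_vec n" using D ab(1) by (rule mult_mat_vec_carrier)
  have Dai: "(?D *\<^sub>v a) $ i = d i * a $ i" if "i < n" for i
  proof -
    have "(?D *\<^sub>v a) $ i = (\<Sum>j<n. (if i = j then d j else 0) * a $ j)"
      using that ab by (auto simp: mat_diag_def scalar_prod_def lessThan_atLeast0 intro!: sum.cong)
    also have "\<dots> = (\<Sum>j<n. if i = j then d j * a $ j else 0)"
      by (intro sum.cong) auto
    finally show ?thesis using that by simp
  qed
  have "A_h l N s = ?Q * ?D * ?Q\<^sup>T" by (simp add: A_h_def n_def d_def[abs_def])
  then have "A_h l N s *\<^sub>v v = ?Q *\<^sub>v (?D *\<^sub>v a)"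
    unfolding a_def
    by (simp only: assoc_mult_mat_vec[OF mult_carrier_mat[OF Q(1) D] Q(2) vz(1)]
        assoc_mult_mat_vec[OF Q(1) D mult_mat_vec_carrier[OF Q(2) vz(1)]])
  then have "(A_h l N s *\<^sub>v v) \<bullet> z = ((?Q\<^sup>T)\<^sup>T *\<^sub>v (?D *\<^sub>v a)) \<bullet> z" by simp
  also have "\<dots> = (?D *\<^sub>v a) \<bullet> b"
    unfolding b_def by (rule transpose_vec_mult_scalar[OF Q(2) vz(2) Da])
  also have "\<dots> = (\<Sum>k<n. d k * (a $ k * b $ k))"
    using ab Dai by (auto simp: scalar_prod_def lessThan_atLeast0 intro!: sum.cong)
  finally show ?thesis by (simp add: inner_h_def a_def b_def d_def n_def)
qed

lemma inner_h_A_h_commute: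
  assumes "v \<in> carrier_vec (N - 1)" "z \<in> carrier_vec (N - 1)"
  shows "inner_h l N (A_h l N s *\<^sub>v v) z = inner_h l N (A_h l N s *\<^sub>v z) v"
  using assms by (simp add: inner_h_A_h mult.commute mult.left_commute)

lemma inner_h_A_h_nonneg:
  assumes "l \<ge> 0" "v \<in> carrier_vec (N - 1)"
  shows "inner_h l N (A_h l N s *\<^sub>v v) v \<ge> 0"
  unfolding inner_h_A_h[OF assms(2,2)] mesh_def
  using assms by (intro mult_nonneg_nonneg[of "l / real N"] mult_nonneg_nonneg[of "_ powr _"] sum_nonneg) simp_all

lemma norm_A_power2:
  "l \<ge> 0 \<Longrightarrow> v \<in> carrier_vec (N - 1) \<Longrightarrow> (norm_A l N s v)\<^sup>2 = inner_h l N (A_h l N s *\<^sub>v v) v"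
  by (simp add: norm_A_def inner_h_A_h_nonneg)

section \<open>Stability of one Crank--Nicolson step\<close>

text \<open>The test vector stays free: it becomes the sum and the difference of two errors for
  stability, and the residual itself for consistency.\<close>

lemma crank_nicolson_step_tested:
  assumes x: "x \<in> carrier_vec (N - 1)" and y: "y \<in> carrier_vec (N - 1)" and z: "z \<in> carrier_vec (N - 1)"
  shows "inner_h l N z ((1 / \<tau>) \<cdot>\<^sub>v (y - x) + A_h l N s *\<^sub>v ((1 / 2) \<cdot>\<^sub>v (y + x)))
    = (inner_h l N z y - inner_h l N z x) / \<tau>
      + (inner_h l N z (A_h l N s *\<^sub>v y) + inner_h l N z (A_h l N s *\<^sub>v x)) / 2"
proof -
  note A = A_h_carrier[of l N s]
  note Ac = mult_mat_vec_carrier[OF A]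
  have "A_h l N s *\<^sub>v ((1 / 2) \<cdot>\<^sub>v (y + x)) = (1 / 2) \<cdot>\<^sub>v (A_h l N s *\<^sub>v y + A_h l N s *\<^sub>v x)"
    using x y by (simp add: mult_mat_vec[OF A] mult_add_distrib_mat_vec[OF A])
  then show ?thesis
    using x y z Ac[OF x] Ac[OF y] by (simp add: inner_h_linear[where n="N - 1"] add_divide_distrib diff_divide_distrib)
qed

lemma crank_nicolson_step_norm_h:
  assumes l: "l \<ge> 0" and \<tau>: "\<tau> > 0"
    and x: "x \<in> carrier_vec (N - 1)" and y: "y \<in> carrier_vec (N - 1)"
    and R: "(1 / \<tau>) \<cdot>\<^sub>v (y - x) + A_h l N s *\<^sub>v ((1 / 2) \<cdot>\<^sub>v (y + x)) = R"
  shows "norm_h l N y \<le> norm_h l N x + \<tau> * norm_h l N R"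
proof -
  note Ac = mult_mat_vec_carrier[OF A_h_carrier[of l N s]]
  have Rc: "R \<in> carrier_vec (N - 1)"
    using x y Ac by (auto simp flip: R)
  have yx: "y + x \<in> carrier_vec (N - 1)" using x y by simp
  let ?e = "inner_h l N" and ?A = "\<lambda>v. A_h l N s *\<^sub>v v"
  have "?e (y + x) R = (?e (y + x) y - ?e (y + x) x) / \<tau> + (?e (y + x) (?A y) + ?e (y + x) (?A x)) / 2"
    unfolding R[symmetric] by (rule crank_nicolson_step_tested[OF x y yx])
  also have "?e (y + x) y - ?e (y + x) x = ?e y y - ?e x x"
    using x y by (simp add: inner_h_linear[where n="N - 1"] inner_h_commute[OF x y])
  also have "?e (y + x) (?A y) + ?e (y + x) (?A x) = ?e (?A (y + x)) (y + x)"
    using x y yx Ac by (simp add: mult_add_distrib_mat_vec[OF A_h_carrier]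
        inner_h_linear[where n="N - 1"] inner_h_commute[where n="N - 1"])
  finally have "?e y y - ?e x x \<le> \<tau> * ?e (y + x) R"
    using mult_nonneg_nonneg[OF less_imp_le[OF \<tau>] inner_h_A_h_nonneg[OF l yx, of s]] \<tau>
    by (simp add: field_simps)
  also have "?e (y + x) R = ?e y R + ?e x R"
    using x y Rc by (simp add: inner_h_linear[where n="N - 1"])
  also have "\<dots> \<le> (norm_h l N y + norm_h l N x) * norm_h l N R"
    using inner_h_Cauchy_Schwarz[OF l y Rc, of N] inner_h_Cauchy_Schwarz[OF l x Rc, of N]
    by (simp add: distrib_right)
  finally have "(norm_h l N y)\<^sup>2 - (norm_h l N x)\<^sup>2 \<le> \<tau> * ((norm_h l N y + norm_h l N x) * norm_h l N R)"
    using \<tau> l by (simp add: norm_h_power2)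
  \<comment> \<open>The sum of the norms cancels if it is positive; otherwise
    \<open>norm_h l N y\<close> is zero and the claim is trivial.\<close>
  then have "(norm_h l N y + norm_h l N x) * (norm_h l N y - norm_h l N x - \<tau> * norm_h l N R) \<le> 0"
    by (simp add: algebra_simps power2_eq_square)
  moreover have "norm_h l N y \<ge> 0" "norm_h l N x \<ge> 0" "\<tau> * norm_h l N R \<ge> 0"
    using l \<tau> by (simp_all add: norm_h_nonneg)
  ultimately show ?thesis
    by (smt (verit) mult_pos_pos)
qed

text \<open>Tested with \<open>y - x\<close>, the time difference is the square
  \<open>p\<^sup>2 / \<tau>\<close>, which is available to absorb the source term, while the
  \<open>A_h\<close> term becomes a difference of energies.\<close>

lemma crank_nicolson_step_norm_A:
  assumes l: "l \<ge> 0" and \<tau>: "\<tau> > 0"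
    and x: "x \<in> carrier_vec (N - 1)" and y: "y \<in> carrier_vec (N - 1)"
    and R: "(1 / \<tau>) \<cdot>\<^sub>v (y - x) + A_h l N s *\<^sub>v ((1 / 2) \<cdot>\<^sub>v (y + x)) = R"
  shows "(norm_A l N s y)\<^sup>2 \<le> (norm_A l N s x)\<^sup>2 + \<tau> / 2 * (norm_h l N R)\<^sup>2"
proof -
  note Ac = mult_mat_vec_carrier[OF A_h_carrier[of l N s]]
  have Rc: "R \<in> carrier_vec (N - 1)"
    using x y Ac by (auto simp flip: R)
  have yx: "y - x \<in> carrier_vec (N - 1)" using x y by simp
  let ?e = "inner_h l N" and ?A = "\<lambda>v. A_h l N s *\<^sub>v v"
  define p where "p = norm_h l N (y - x)"
  define q where "q = norm_h l N R"
  have "?e (y - x) R = (?e (y - x) y - ?e (y - x) x) / \<tau> + (?e (y - x) (?A y) + ?e (y - x) (?A x)) / 2"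
    unfolding R[symmetric] by (rule crank_nicolson_step_tested[OF x y yx])
  also have "?e (y - x) y - ?e (y - x) x = p\<^sup>2"
    using x y l unfolding p_def by (simp add: inner_h_linear[where n="N - 1"] norm_h_power2)
  \<comment> \<open>The mixed terms cancel by symmetry of \<open>A_h\<close>.\<close>
  also have "?e (y - x) (?A y) + ?e (y - x) (?A x) = ?e (?A y) y - ?e (?A x) x"
    using x y Ac inner_h_A_h_commute[OF x y, of l s]
    by (simp add: inner_h_linear[where n="N - 1"] inner_h_commute[OF _ Ac])
  also have "\<dots> = (norm_A l N s y)\<^sup>2 - (norm_A l N s x)\<^sup>2"
    using x y l by (simp add: norm_A_power2)
  finally have "p\<^sup>2 / \<tau> + ((norm_A l N s y)\<^sup>2 - (norm_A l N s x)\<^sup>2) / 2 \<le> p * q"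
    using inner_h_Cauchy_Schwarz[OF l yx Rc, of N] unfolding p_def q_def by simp
  \<comment> \<open>Young's inequality, weighted so that its first term is exactly the square on the
    left; the remaining \<tau>/4 doubles to \<tau>/2 when the factor 1/2 of the energies is
    cleared.\<close>
  also have "p * q \<le> p\<^sup>2 / \<tau> + \<tau> / 4 * q\<^sup>2"
  proof -
    have "0 \<le> (p - \<tau> / 2 * q)\<^sup>2 / \<tau>" using \<tau> by simp
    also have "\<dots> = p\<^sup>2 / \<tau> - p * q + \<tau> / 4 * q\<^sup>2"
      using \<tau> by (simp add: power2_eq_square field_simps)
    finally show ?thesis by simp
  qed
  finally show ?thesis by (simp add: q_def)
qed

section \<open>Truncation error\<close>

text \<open>\<open>vector_derivative\<close> is a choice operator; differentiability at every order
  below \<open>k\<close> makes its iterates genuine derivatives.\<close>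

lemma Ck_on_has_derivative:
  assumes "Ck_on k S g" "j < k" "t \<in> S"
  shows "((deriv_on S ^^ j) g has_real_derivative (deriv_on S ^^ Suc j) g t) (at t within S)"
  using assms
  by (auto simp: Ck_on_def differentiable_on_def deriv_on_def has_real_derivative_iff_has_vector_derivative
      simp flip: vector_derivative_works)

text \<open>In the difference of the Taylor expansions at the two end points about the midpoint the
  terms of even order cancel, so only the cubic remainders are left.\<close>

lemma central_difference_error:
  fixes g :: "nat \<Rightarrow> real \<Rightarrow> real"
  assumes "a < b"
    and g: "\<And>k t. k \<le> 2 \<Longrightarrow> t \<in> {a..b} \<Longrightarrow> (g k has_real_derivative g (Suc k) t) (at t within {a..b})"
    and B: "\<And>t. t \<in> {a..b} \<Longrightarrow> \<bar>g 3 t\<bar> \<le> B"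
  shows "\<bar>(g 0 b - g 0 a) / (b - a) - g 1 ((a + b) / 2)\<bar> \<le> B / 8 * (b - a)\<^sup>2"
proof -
  define m where "m = (a + b) / 2"
  define d where "d = (b - a) / 2"
  define Q where "Q x = g 0 m + g 1 m * x + g 2 m * x\<^sup>2 / 2" for x
  have d: "d > 0" "b - m = d" "a - m = - d" "b - a = 2 * d" and m: "m \<in> {a..b}"
    using assms(1) by (auto simp: m_def d_def field_simps)
  \<comment> \<open>The remainder in \<open>field_Taylor\<close> is divided by 2! instead of 3!,
    hence the final factor 1/8 where 1/24 would be sharp.\<close>
  have T: "\<bar>g 0 z - Q (z - m)\<bar> \<le> B * \<bar>z - m\<bar> ^ 3 / 2" if "z \<in> {a..b}" for z
    using field_Taylor[of "{a..b}" 2 g B m z] g B m that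
    by (simp add: eval_nat_numeral One_nat_def Q_def)
  have "\<bar>g 0 b - Q d\<bar> \<le> B * d ^ 3 / 2" "\<bar>g 0 a - Q (- d)\<bar> \<le> B * d ^ 3 / 2"
    using T[of b] T[of a] d assms(1) by auto
  moreover have "Q d - Q (- d) = 2 * d * g 1 m" by (simp add: Q_def)
  ultimately have "\<bar>g 0 b - g 0 a - 2 * d * g 1 m\<bar> \<le> B * d ^ 3" by linarith
  then have "\<bar>g 0 b - g 0 a - 2 * d * g 1 m\<bar> / (2 * d) \<le> B * d ^ 3 / (2 * d)"
    using d by (intro divide_right_mono) auto
  moreover have "\<bar>g 0 b - g 0 a - 2 * d * g 1 m\<bar> / (2 * d) = \<bar>(g 0 b - g 0 a) / (2 * d) - g 1 m\<bar>"
    using d by (simp add: diff_divide_distrib abs_if divide_less_0_iff)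
      (simp add: field_simps)
  moreover have "B * d ^ 3 / (2 * d) = B / 8 * (2 * d)\<^sup>2"
    using d by (simp add: power3_eq_cube power2_eq_square)
  ultimately show ?thesis by (simp add: d(4) m_def)
qed

text \<open>Here the linear terms cancel in the average, and two derivatives suffice. The remainder
  of \<open>field_Taylor\<close> carries 1! instead of 2!, which gives 1/4 where 1/8 would be
  sharp.\<close>

lemma midpoint_average_error:
  fixes g :: "nat \<Rightarrow> real \<Rightarrow> real"
  assumes "a < b"
    and g: "\<And>k t. k \<le> 1 \<Longrightarrow> t \<in> {a..b} \<Longrightarrow> (g k has_real_derivative g (Suc k) t) (at t within {a..b})"
    and B: "\<And>t. t \<in> {a..b} \<Longrightarrow> \<bar>g 2 t\<bar> \<le> B"
  shows "\<bar>(g 0 b + g 0 a) / 2 - g 0 ((a + b) / 2)\<bar> \<le> B / 4 * (b - a)\<^sup>2"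
proof -
  define m where "m = (a + b) / 2"
  define d where "d = (b - a) / 2"
  have d: "d > 0" "b - m = d" "a - m = - d" "b - a = 2 * d" and m: "m \<in> {a..b}"
    using assms(1) by (auto simp: m_def d_def field_simps)
  have T: "\<bar>g 0 z - (g 0 m + g 1 m * (z - m))\<bar> \<le> B * \<bar>z - m\<bar>\<^sup>2" if "z \<in> {a..b}" for z
    using field_Taylor[of "{a..b}" 1 g B m z] g B m that
    by (simp add: eval_nat_numeral One_nat_def)
  have "\<bar>g 0 b - (g 0 m + g 1 m * d)\<bar> \<le> B * d\<^sup>2" "\<bar>g 0 a - (g 0 m - g 1 m * d)\<bar> \<le> B * d\<^sup>2"
    using T[of b] T[of a] d assms(1) by auto
  then have "\<bar>(g 0 b + g 0 a) / 2 - g 0 m\<bar> \<le> B * d\<^sup>2"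
    unfolding abs_le_iff by (simp add: field_simps)
  then show ?thesis by (simp add: d(4) m_def power2_eq_square)
qed

text \<open>The pairing is a finite combination, with coefficients constant in time, of values at
  interior nodes, so it is differentiated node by node.\<close>

lemma inner_h_grid_dt_has_derivative:
  assumes "l > 0" and z: "z \<in> carrier_vec (N - 1)"
    and C: "\<And>x. x \<in> {0<..<l} \<Longrightarrow> Ck_on m {0..T} (\<lambda>t. w t x)"
    and "k < m" and t: "t \<in> {0..T}"
  shows "((\<lambda>t. inner_h l N z (grid l N (dt T k w t))) has_real_derivative
    inner_h l N z (grid l N (dt T (Suc k) w t))) (at t within {0..T})"
proof -
  have *: "inner_h l N z (grid l N v) = mesh l N * (\<Sum>i<N - 1. z $ i * v (real (Suc i) * mesh l N))" for v
    by (subst inner_h_sum[OF grid_carrier]) (simp add: grid_def)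
  have x: "real (Suc i) * mesh l N \<in> {0<..<l}" if "i < N - 1" for i
    using that assms(1) by (auto simp: mesh_def field_simps simp del: of_nat_Suc)
  have "((\<lambda>t. dt T k w t x) has_real_derivative dt T (Suc k) w t x) (at t within {0..T})"
    if "x \<in> {0<..<l}" for x
    using Ck_on_has_derivative[OF C[OF that] assms(4) t] by (simp add: dt_def)
  then show ?thesis
    unfolding * using x by (intro DERIV_cmult DERIV_sum) auto
qed

text \<open>\<open>R\<close> is the residual of the exact solution in the scheme. It splits into the
  central difference error for the time derivative, the averaging error for the fractional Laplacian
  of the solution, and the spatial consistency error at the two time levels.\<close>

lemma crank_nicolson_truncation:
  fixes l T s C_t C_v :: real
    and u f Lsu :: "real \<Rightarrow> real \<Rightarrow> real"
    and r :: "real \<Rightarrow> real"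
    and N M n :: nat
  defines "t1 \<equiv> time_pt T M n" and "t2 \<equiv> time_pt T M (Suc n)"
    and "tm \<equiv> time_mid T M n" and "\<tau> \<equiv> time_step T M"
  defines "R \<equiv> (1 / \<tau>) \<cdot>\<^sub>v (grid l N (u t2) - grid l N (u t1))
      + A_h l N s *\<^sub>v ((1 / 2) \<cdot>\<^sub>v (grid l N (u t2) + grid l N (u t1)))
      - r tm \<cdot>\<^sub>v grid l N (f tm)"
  assumes "l > 0" and "T > 0" and "n < M"
    and C3_u: "\<And>x. x \<in> {0<..<l} \<Longrightarrow> Ck_on 3 {0..T} (\<lambda>t. u t x)"
    and C2_rf: "\<And>x. x \<in> {0<..<l} \<Longrightarrow> Ck_on 2 {0..T} (\<lambda>t. r t * f t x)"
    and equation: "\<And>t x. t \<in> {0..T} \<Longrightarrow> x \<in> {0<..<l} \<Longrightarrow> dt T 1 u t x + Lsu t x = r t * f t x"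
    and time_bound: "\<And>t. t \<in> {0..T} \<Longrightarrow>
      norm_h l N (grid l N (dt T 3 u t)) + norm_h l N (grid l N (dt T 2 (\<lambda>t x. r t * f t x) t)) \<le> C_t"
    and consistency: "\<And>t. t \<in> {0..T} \<Longrightarrow>
      norm_h l N (A_h l N s *\<^sub>v grid l N (u t) - grid l N (Lsu t)) \<le> C_v * (mesh l N)\<^sup>2"
  shows "norm_h l N R \<le> C_t * \<tau>\<^sup>2 + C_v * (mesh l N)\<^sup>2"
proof -
  let ?e = "inner_h l N" and ?A = "\<lambda>v. A_h l N s *\<^sub>v v" and ?n = "norm_h l N"
  let ?rf = "\<lambda>t x. r t * f t x"
  note Ac = mult_mat_vec_carrier[OF A_h_carrier[of l N s]]
  have l: "l \<ge> 0" using assms by simp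
  have \<tau>: "\<tau> > 0" using assms by (simp add: time_step_def)
  have t12: "t2 - t1 = \<tau>" "t1 < t2" and tm: "tm = (t1 + t2) / 2"
    using \<tau> by (simp_all add: t1_def t2_def tm_def \<tau>_def time_mid_def time_pt_def algebra_simps)
  have "t1 \<ge> 0" using \<tau> by (simp add: t1_def time_pt_def \<tau>_def)
  moreover have "t2 \<le> T"
  proof -
    have "real (Suc n) * T \<le> real M * T" using assms by (intro mult_right_mono) auto
    then show ?thesis
      using assms by (simp add: t2_def time_pt_def time_step_def field_simps del: of_nat_Suc)
  qed
  ultimately have sub: "{t1..t2} \<subseteq> {0..T}" by auto
  have tin: "t1 \<in> {0..T}" "t2 \<in> {0..T}" "tm \<in> {0..T}"
    using sub t12 by (auto simp: tm)
  have Rc: "R \<in> carrier_vec (N - 1)" unfolding R_def using Ac by simp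
  \<comment> \<open>Up to the last estimate \<open>z\<close> acts only as a fixed vector; its value
    matters when the pairing of \<open>z\<close> with \<open>R\<close> is read as a squared
    norm.\<close>
  define z where "z = R"
  have z: "z \<in> carrier_vec (N - 1)" using Rc by (simp add: z_def)
  note lin = inner_h_linear[where n="N - 1"]
  define g where "g k t = ?e z (grid l N (dt T k u t))" for k t
  \<comment> \<open>By the equation, \<open>w 0\<close> is the pairing with \<open>Lsu\<close>; this
    form shows its two time derivatives without any smoothness assumed of \<open>Lsu\<close> in
    time.\<close>
  define w where "w k t = ?e z (grid l N (dt T k ?rf t)) - g (Suc k) t" for k t
  have w0: "w 0 t = ?e z (grid l N (dt T 0 ?rf t)) - g 1 t" for t
    by (simp add: w_def One_nat_def)
  have dg: "(g k has_real_derivative g (Suc k) t) (at t within {t1..t2})" if "k \<le> 2" "t \<in> {t1..t2}" for k t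
    unfolding g_def using that sub
    by (intro DERIV_subset[OF inner_h_grid_dt_has_derivative[OF \<open>l > 0\<close> z C3_u] sub]) auto
  have dw: "(w k has_real_derivative w (Suc k) t) (at t within {t1..t2})" if "k \<le> 1" "t \<in> {t1..t2}" for k t
    unfolding w_def using that sub
    by (intro DERIV_diff dg DERIV_subset[OF inner_h_grid_dt_has_derivative[OF \<open>l > 0\<close> z C2_rf] sub]) auto
  have CS: "\<bar>?e z v\<bar> \<le> ?n z * ?n v" if "v \<in> carrier_vec (N - 1)" for v
    by (rule inner_h_Cauchy_Schwarz[OF l z that])
  \<comment> \<open>\<open>C_t\<close> bounds the sum of both norms, so the triangle inequality for
    \<open>w 2\<close> costs no extra factor.\<close>
  have bound: "\<bar>g 3 t\<bar> \<le> ?n z * C_t \<and> \<bar>w 2 t\<bar> \<le> ?n z * C_t" if "t \<in> {t1..t2}" for t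
  proof -
    let ?a = "?n (grid l N (dt T 3 u t))" and ?b = "?n (grid l N (dt T 2 ?rf t))"
    have 1: "?n z * (?a + ?b) \<le> ?n z * C_t"
      using that sub by (intro mult_left_mono time_bound) (auto simp: norm_h_nonneg l)
    have 2: "\<bar>g 3 t\<bar> \<le> ?n z * ?a" "\<bar>w 2 t + g 3 t\<bar> \<le> ?n z * ?b"
      using CS[OF grid_carrier[of l N "dt T 3 u t"]] CS[OF grid_carrier[of l N "dt T 2 ?rf t"]]
      by (simp_all add: g_def w_def numeral_3_eq_3)
    have 3: "?n z * ?b \<ge> 0" using l by (simp add: norm_h_nonneg)
    show ?thesis using 1 2 3 unfolding distrib_left by linarith
  qed
  have G: "\<bar>(g 0 t2 - g 0 t1) / \<tau> - g 1 tm\<bar> \<le> ?n z * C_t / 8 * \<tau>\<^sup>2"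
    unfolding tm t12(1)[symmetric] using bound by (intro central_difference_error t12 dg) auto
  have W: "\<bar>(w 0 t2 + w 0 t1) / 2 - w 0 tm\<bar> \<le> ?n z * C_t / 4 * \<tau>\<^sup>2"
    unfolding tm t12(1)[symmetric] using bound by (intro midpoint_average_error t12 dw) auto
  have gridL: "?e z (grid l N (Lsu t)) = w 0 t" if t: "t \<in> {0..T}" for t
  proof -
    have x: "real (Suc i) * mesh l N \<in> {0<..<l}" if "i < N - 1" for i
      using that assms(6) by (auto simp: mesh_def field_simps simp del: of_nat_Suc)
    have "grid l N (Lsu t) = grid l N (dt T 0 ?rf t) - grid l N (dt T 1 u t)"
    proof (rule eq_vecI)
      fix i assume "i < dim_vec (grid l N (dt T 0 ?rf t) - grid l N (dt T 1 u t))"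
      then have "i < N - 1" by (simp add: grid_def)
      then show "grid l N (Lsu t) $ i = (grid l N (dt T 0 ?rf t) - grid l N (dt T 1 u t)) $ i"
        using equation[OF t x[of i]] by (simp add: grid_def dt_def algebra_simps)
    qed (simp add: grid_def)
    then show ?thesis
      using z by (simp add: w0 g_def lin)
  qed
  have K: "\<bar>?e z (?A (grid l N (u t))) - w 0 t\<bar> \<le> ?n z * (C_v * (mesh l N)\<^sup>2)" if t: "t \<in> {0..T}" for t
  proof -
    have "?e z (?A (grid l N (u t))) - w 0 t = ?e z (?A (grid l N (u t)) - grid l N (Lsu t))"
      using z Ac by (simp add: lin gridL[OF t])
    also have "\<bar>\<dots>\<bar> \<le> ?n z * ?n (?A (grid l N (u t)) - grid l N (Lsu t))"
      using Ac by (intro CS) simp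
    also have "\<dots> \<le> ?n z * (C_v * (mesh l N)\<^sup>2)"
      by (intro mult_left_mono consistency t norm_h_nonneg l)
    finally show ?thesis .
  qed
  \<comment> \<open>The source at the midpoint supplies exactly the two midpoint values that occur
    in \<open>G\<close> and \<open>W\<close>.\<close>
  have F: "?e z (r tm \<cdot>\<^sub>v grid l N (f tm)) = w 0 tm + g 1 tm"
  proof -
    have "r tm \<cdot>\<^sub>v grid l N (f tm) = grid l N (dt T 0 ?rf tm)"
      by (auto simp: grid_def dt_def)
    then show ?thesis by (simp add: w0)
  qed
  have "?e z R = (g 0 t2 - g 0 t1) / \<tau>
      + (?e z (?A (grid l N (u t2))) + ?e z (?A (grid l N (u t1)))) / 2 - (w 0 tm + g 1 tm)"
  proof -
    let ?S = "(1 / \<tau>) \<cdot>\<^sub>v (grid l N (u t2) - grid l N (u t1))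
      + ?A ((1 / 2) \<cdot>\<^sub>v (grid l N (u t2) + grid l N (u t1)))"
    have "?S \<in> carrier_vec (N - 1)" using Ac by simp
    then have "?e z R = ?e z ?S - ?e z (r tm \<cdot>\<^sub>v grid l N (f tm))"
      unfolding R_def by (intro inner_h_diff_right[where n="N - 1"] z) simp_all
    moreover have "dt T 0 u t = u t" for t by (simp add: dt_def fun_eq_iff)
    ultimately show ?thesis
      unfolding F using z by (simp add: crank_nicolson_step_tested g_def)
  qed
  also have "\<dots> \<le> ?n z * C_t / 8 * \<tau>\<^sup>2 + ?n z * C_t / 4 * \<tau>\<^sup>2 + ?n z * (C_v * (mesh l N)\<^sup>2)"
    using G W K[OF tin(1)] K[OF tin(2)] unfolding abs_le_iff by argo
  \<comment> \<open>The temporal constants add up to 1/8 + 1/4, which is at most 1.\<close>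
  also have "\<dots> \<le> ?n z * (C_t * \<tau>\<^sup>2 + C_v * (mesh l N)\<^sup>2)"
  proof -
    have "\<bar>g 3 t1\<bar> \<le> ?n z * C_t" using bound[of t1] t12 by auto
    then have "0 \<le> ?n z * C_t * \<tau>\<^sup>2" by simp
    then show ?thesis by (simp add: algebra_simps)
  qed
  \<comment> \<open>One factor \<open>?n R\<close> is cancelled; if it is zero, the claim follows
    from nonnegativity of the bound.\<close>
  finally have "?n R * ?n R \<le> ?n R * (C_t * \<tau>\<^sup>2 + C_v * (mesh l N)\<^sup>2)"
    using l by (simp add: z_def power2_eq_square flip: norm_h_power2)
  moreover have "?n R \<ge> 0" using l by (rule norm_h_nonneg)
  moreover have "C_t \<ge> 0"
    using time_bound[OF tin(1)] norm_h_nonneg[OF l] by (smt (verit))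
  moreover have "C_v * (mesh l N)\<^sup>2 \<ge> 0"
    using consistency[OF tin(1)] norm_h_nonneg[OF l] by (smt (verit))
  ultimately show ?thesis
    by (cases "?n R = 0") (auto simp: mult_le_cancel_left)
qed

section \<open>Error equation and global error bounds\<close>

text \<open>By linearity the error satisfies the scheme with the residual of \<open>v\<close>,
  \<open>v'\<close> as source, so the one-step stability bounds apply to it.\<close>

lemma crank_nicolson_error_equation:
  assumes "v \<in> carrier_vec (N - 1)" "v' \<in> carrier_vec (N - 1)"
    and "U \<in> carrier_vec (N - 1)" "U' \<in> carrier_vec (N - 1)"
    and "(1 / \<tau>) \<cdot>\<^sub>v (U' - U) + A_h l N s *\<^sub>v ((1 / 2) \<cdot>\<^sub>v (U' + U)) = F"
  shows "(1 / \<tau>) \<cdot>\<^sub>v ((v' - U') - (v - U)) + A_h l N s *\<^sub>v ((1 / 2) \<cdot>\<^sub>v ((v' - U') + (v - U)))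
    = (1 / \<tau>) \<cdot>\<^sub>v (v' - v) + A_h l N s *\<^sub>v ((1 / 2) \<cdot>\<^sub>v (v' + v)) - F"
proof -
  note A = A_h_carrier[of l N s]
  define a where "a = (1 / 2) \<cdot>\<^sub>v (v' + v)"
  define b where "b = (1 / 2) \<cdot>\<^sub>v (U' + U)"
  have ab: "a \<in> carrier_vec (N - 1)" "b \<in> carrier_vec (N - 1)"
    using assms by (simp_all add: a_def b_def)
  have "(1 / 2) \<cdot>\<^sub>v ((v' - U') + (v - U)) = a - b"
    using assms by (intro eq_vecI) (auto simp: a_def b_def field_simps)
  then have "A_h l N s *\<^sub>v ((1 / 2) \<cdot>\<^sub>v ((v' - U') + (v - U))) = A_h l N s *\<^sub>v a - A_h l N s *\<^sub>v b"
    using ab by (simp add: mult_minus_distrib_mat_vec[OF A])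
  moreover have "(1 / \<tau>) \<cdot>\<^sub>v ((v' - U') - (v - U)) + (p - q)
      = (1 / \<tau>) \<cdot>\<^sub>v (v' - v) + p - ((1 / \<tau>) \<cdot>\<^sub>v (U' - U) + q)"
    if "p \<in> carrier_vec (N - 1)" "q \<in> carrier_vec (N - 1)" for p q
    using assms(1-4) that by (intro eq_vecI) (auto simp: diff_divide_distrib)
  ultimately show ?thesis
    using ab mult_mat_vec_carrier[OF A] unfolding assms(5)[symmetric] a_def b_def by simp
qed

theorem theorem4p7:
  fixes l T s C_t C_v :: real
    and u f Lsu :: "real \<Rightarrow> real \<Rightarrow> real"
    and r \<phi> :: "real \<Rightarrow> real"
  assumes "l > 0" and "T > 0" and "0 < s" and "s < 1"
    and Lsu: "\<And>t. t \<in> {0..T} \<Longrightarrow> frac_lap l s (u t) (Lsu t)"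
    and cont_u: "\<And>t. t \<in> {0..T} \<Longrightarrow> continuous_on {0..l} (u t)"
    and cont_ut: "\<And>t. t \<in> {0..T} \<Longrightarrow> continuous_on {0<..<l} (dt T 1 u t)"
    and cont_rf: "\<And>t. t \<in> {0..T} \<Longrightarrow> continuous_on {0<..<l} (\<lambda>x. r t * f t x)"
    and cont_Lsu: "\<And>t. t \<in> {0..T} \<Longrightarrow> continuous_on {0<..<l} (Lsu t)"
    and C3_u: "\<And>x. x \<in> {0<..<l} \<Longrightarrow> Ck_on 3 {0..T} (\<lambda>t. u t x)"
    and C2_rf: "\<And>x. x \<in> {0<..<l} \<Longrightarrow> Ck_on 2 {0..T} (\<lambda>t. r t * f t x)"
    and equation: "\<And>t x. t \<in> {0..T} \<Longrightarrow> x \<in> {0<..<l} \<Longrightarrow> dt T 1 u t x + Lsu t x = r t * f t x"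
    and initial: "\<And>x. x \<in> {0..l} \<Longrightarrow> u 0 x = \<phi> x"
    and boundary: "\<And>t. t \<in> {0..T} \<Longrightarrow> u t 0 = 0 \<and> u t l = 0"
    and time_bound: "\<And>N t. N \<ge> 2 \<Longrightarrow> t \<in> {0..T} \<Longrightarrow>
      norm_h l N (grid l N (dt T 3 u t)) + norm_h l N (grid l N (dt T 2 (\<lambda>t x. r t * f t x) t)) \<le> C_t"
    and consistency: "\<And>N t. N \<ge> 2 \<Longrightarrow> t \<in> {0..T} \<Longrightarrow>
      norm_h l N (A_h l N s *\<^sub>v grid l N (u t) - grid l N (Lsu t)) \<le> C_v * (mesh l N)\<^sup>2"
  shows "\<exists>C>0. \<forall>N M U. N \<ge> 2 \<longrightarrow> M \<ge> 1 \<longrightarrow>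
    crank_nicolson l T s r f N M U \<longrightarrow> U 0 = grid l N (u 0) \<longrightarrow>
    (MAX n\<in>{0..M}. norm_h l N (grid l N (u (time_pt T M n)) - U n))
      \<le> C * ((time_step T M)\<^sup>2 + (mesh l N)\<^sup>2) \<and>
    (MAX n\<in>{0..M}. norm_A l N s (grid l N (u (time_pt T M n)) - U n))
      \<le> C * ((time_step T M)\<^sup>2 + (mesh l N)\<^sup>2)"
proof -
  define K where "K = C_t + \<bar>C_v\<bar>"
  \<comment> \<open>\<open>T * K\<close> serves the first norm and \<open>sqrt (T / 2) * K\<close>
    the energy norm; the summand 1 keeps \<open>C\<close> positive when \<open>K\<close> is
    zero.\<close>
  define C where "C = (T + sqrt (T / 2)) * K + 1"
  have l: "l \<ge> 0" using \<open>l > 0\<close> by simp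
  have Ct: "C_t \<ge> 0"
    using time_bound[of 2 0] norm_h_nonneg[OF l] \<open>T > 0\<close> by (smt (verit) atLeastAtMost_iff order_refl)
  then have K: "K \<ge> 0" by (simp add: K_def)
  have C: "C > 0" "T * K \<le> C" "sqrt (T / 2) * K \<le> C"
    using K \<open>T > 0\<close> by (auto simp: C_def distrib_right add_nonneg_pos add_increasing)
  have est: "norm_h l N (grid l N (u (time_pt T M n)) - U n) \<le> C * ((time_step T M)\<^sup>2 + (mesh l N)\<^sup>2) \<and>
      norm_A l N s (grid l N (u (time_pt T M n)) - U n) \<le> C * ((time_step T M)\<^sup>2 + (mesh l N)\<^sup>2)"
    if N: "N \<ge> 2" and M: "M \<ge> 1" and cn: "crank_nicolson l T s r f N M U"
      and U0: "U 0 = grid l N (u 0)" and n: "n \<le> M" for N M n U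
  proof -
    define \<tau> where "\<tau> = time_step T M"
    define D where "D = \<tau>\<^sup>2 + (mesh l N)\<^sup>2"
    define e where "e k = grid l N (u (time_pt T M k)) - U k" for k
    have \<tau>: "\<tau> > 0" using M \<open>T > 0\<close> by (simp add: \<tau>_def time_step_def)
    have D: "D \<ge> 0" by (simp add: D_def)
    have Uc: "U k \<in> carrier_vec (N - 1)" if "k \<le> M" for k
      using cn that by (simp add: crank_nicolson_def)
    then have ec: "e k \<in> carrier_vec (N - 1)" if "k \<le> M" for k
      using that by (simp add: e_def)
    have e0: "e 0 = 0\<^sub>v (N - 1)"
      using U0 by (auto simp: e_def time_pt_def grid_def)
    define R where "R k = (1 / \<tau>) \<cdot>\<^sub>v (e (Suc k) - e k) + A_h l N s *\<^sub>v ((1 / 2) \<cdot>\<^sub>v (e (Suc k) + e k))" for k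
    have RK: "norm_h l N (R k) \<le> K * D" if k: "k < M" for k
    proof -
      let ?R = "(1 / \<tau>) \<cdot>\<^sub>v (grid l N (u (time_pt T M (Suc k))) - grid l N (u (time_pt T M k)))
        + A_h l N s *\<^sub>v ((1 / 2) \<cdot>\<^sub>v (grid l N (u (time_pt T M (Suc k))) + grid l N (u (time_pt T M k))))
        - r (time_mid T M k) \<cdot>\<^sub>v grid l N (f (time_mid T M k))"
      have "norm_h l N ?R \<le> C_t * \<tau>\<^sup>2 + C_v * (mesh l N)\<^sup>2"
        unfolding \<tau>_def using N k \<open>l > 0\<close> \<open>T > 0\<close>
        by (intro crank_nicolson_truncation[where Lsu = Lsu and T = T] C3_u C2_rf equation time_bound consistency)
      also have "\<dots> \<le> K * D"
        unfolding D_def K_def distrib_left using Ct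
        by (intro add_mono mult_right_mono) auto
      finally have "norm_h l N ?R \<le> K * D" .
      moreover have "R k = ?R"
        unfolding R_def e_def using cn k Uc[of k] Uc[of "Suc k"]
        by (intro crank_nicolson_error_equation) (auto simp: crank_nicolson_def \<tau>_def)
      ultimately show ?thesis by simp
    qed
    have time: "real n * \<tau> \<le> T"
      using n M \<open>T > 0\<close> by (simp add: \<tau>_def time_step_def field_simps mult_right_mono)
    \<comment> \<open>The initial error vanishes and each step adds at most
      \<open>\<tau> * (K * D)\<close>; since n\<tau> \<le> T, the total stays bounded by
      \<open>T * (K * D)\<close>.\<close>
    have "norm_h l N (e k) \<le> real k * \<tau> * (K * D)" if "k \<le> M" for k
      using that
    proof (induction k)
      case 0
      then show ?case by (simp add: e0 norm_h_def inner_h_def)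
    next
      case (Suc k)
      then have "norm_h l N (e (Suc k)) \<le> norm_h l N (e k) + \<tau> * norm_h l N (R k)"
        by (intro crank_nicolson_step_norm_h[OF l \<tau> _ _ R_def[symmetric]] ec) auto
      also have "\<dots> \<le> real k * \<tau> * (K * D) + \<tau> * (K * D)"
        using Suc RK[of k] \<tau> by (intro add_mono mult_left_mono) auto
      finally show ?case by (simp add: algebra_simps)
    qed
    from this[OF n] have "norm_h l N (e n) \<le> real n * \<tau> * (K * D)" .
    also have "\<dots> \<le> T * (K * D)"
      using time K D by (intro mult_right_mono) auto
    also have "\<dots> = T * K * D" by simp
    also have "\<dots> \<le> C * D"
      using C D by (intro mult_right_mono)
    finally have 1: "norm_h l N (e n) \<le> C * D" .
    \<comment> \<open>In the energy norm the squares accumulate, so the root is taken only after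
      summation and the full order in \<open>D\<close> is kept.\<close>
    have "(norm_A l N s (e k))\<^sup>2 \<le> real k * \<tau> / 2 * (K * D)\<^sup>2" if "k \<le> M" for k
      using that
    proof (induction k)
      case 0
      have "inner_h l N (A_h l N s *\<^sub>v 0\<^sub>v (N - 1)) (0\<^sub>v (N - 1)) = 0"
        using mult_mat_vec_carrier[OF A_h_carrier[of l N s]] by (simp add: inner_h_def)
      then show ?case by (simp add: e0 norm_A_def)
    next
      case (Suc k)
      then have "(norm_A l N s (e (Suc k)))\<^sup>2 \<le> (norm_A l N s (e k))\<^sup>2 + \<tau> / 2 * (norm_h l N (R k))\<^sup>2"
        by (intro crank_nicolson_step_norm_A[OF l \<tau> _ _ R_def[symmetric]] ec) auto
      also have "\<dots> \<le> real k * \<tau> / 2 * (K * D)\<^sup>2 + \<tau> / 2 * (K * D)\<^sup>2"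
        using Suc RK[of k] \<tau> norm_h_nonneg[OF l]
        by (intro add_mono mult_left_mono power_mono) auto
      finally show ?case by (simp add: algebra_simps)
    qed
    from this[OF n] have "(norm_A l N s (e n))\<^sup>2 \<le> real n * \<tau> / 2 * (K * D)\<^sup>2" .
    also have "\<dots> \<le> T / 2 * (K * D)\<^sup>2"
      using time by (intro mult_right_mono) auto
    also have "\<dots> = (sqrt (T / 2) * (K * D))\<^sup>2"
      using \<open>T > 0\<close> by (simp add: power_mult_distrib)
    finally have "norm_A l N s (e n) \<le> sqrt (T / 2) * (K * D)"
      using K D \<open>T > 0\<close> by (elim power2_le_imp_le) simp
    also have "\<dots> = sqrt (T / 2) * K * D" by simp
    also have "\<dots> \<le> C * D"
      using C D by (intro mult_right_mono)
    finally show ?thesis using 1 by (simp add: e_def D_def \<tau>_def)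
  qed
  show ?thesis
    using C(1) est by (intro exI[of _ C]) (auto simp: Max_le_iff)
qed

end
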